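(* Let $X$ be an Archimedean vector lattice and let $Y$ be a linear subspace of $X$ of codimension $1$. Then $Y$ is a uniformly closed sublattice of $X$ if and only if $Y=\ker(\varphi-\psi)$ for some lattice homomorphisms $\varphi,\psi\colon X\to\mathbb R$.
   Context: Vector lattices are over $\mathbb R$. A sublattice is a linear subspace closed under $\vee$ and $\wedge$. Real-valued lattice homomorphisms are linear maps preserving $\vee$ and $\wedge$; the zero functional is allowed. For $e\in X_+$, $I_e$ is the principal ideal generated by $e$, with the norm $\|x\|_e=\inf\{\lambda>0 : |x|\le\lambda e\}$. A net $(x_\alpha)$ in $X$ converges (relatively) uniformly to $x\in X$ if there is $e\in X_+$ with $\|x_\alpha-x\|_e\to 0$ (in particular, $x_\alpha-x\in I_e$ for all sufficiently large $\alpha$). A subset $A\subseteq X$ is uniformly closed if it is closed with respect to uniform convergence; equivalently, $A\cap I_e$ is closed in $(I_e,\|\cdot\|_e)$ for every $e\in X_+$. A subspace $F$ of $X$ has codimension $n$ if $\dim X/F=n$. *)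

theory Defs
  imports "HOL-Analysis.Analysis" "HOL-Library.Lattice_Algebras"
begin

class vector_lattice = ordered_real_vector + lattice_ab_group_add_abs

class archimedean_vector_lattice = vector_lattice +
  assumes archimedean: "0 \<le> x \<Longrightarrow> (\<And>n::nat. real n *\<^sub>R x \<le> y) \<Longrightarrow> x = 0"

instance real :: vector_lattice ..

instance real :: archimedean_vector_lattice
proof
  fix x y :: real
  assume "0 \<le> x" and le: "real n *\<^sub>R x \<le> y" for n :: nat
  show "x = 0"
  proof (rule ccontr)
    assume "x \<noteq> 0"
    with \<open>0 \<le> x\<close> have "0 < x" by simp
    then obtain n :: nat where "y < real n * x"
      using reals_Archimedean3 by blast
    with le[of n] show False by simp
  qed
qed

definition sublattice :: "'a::vector_lattice set \<Rightarrow> bool" where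
  "sublattice S \<longleftrightarrow> subspace S \<and> (\<forall>x\<in>S. \<forall>y\<in>S. sup x y \<in> S \<and> inf x y \<in> S)"

definition lattice_homomorphism :: "('a::vector_lattice \<Rightarrow> 'b::vector_lattice) \<Rightarrow> bool" where
  "lattice_homomorphism f \<longleftrightarrow> linear f \<and>
     (\<forall>x y. f (sup x y) = sup (f x) (f y)) \<and> (\<forall>x y. f (inf x y) = inf (f x) (f y))"

definition order_ideal :: "'a::vector_lattice set \<Rightarrow> bool" where
  "order_ideal I \<longleftrightarrow> subspace I \<and> (\<forall>x y. \<bar>x\<bar> \<le> \<bar>y\<bar> \<longrightarrow> y \<in> I \<longrightarrow> x \<in> I)"

definition principal_ideal :: "'a::vector_lattice \<Rightarrow> 'a set" where
  "principal_ideal e = order_ideal hull {e}"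

text \<open>The infimum is only meaningful for \<open>x\<close> in the principal ideal generated by \<open>e\<close>;
  elsewhere the set is empty and the value unspecified.\<close>

definition ideal_norm :: "'a::vector_lattice \<Rightarrow> 'a \<Rightarrow> real" where
  "ideal_norm e x = Inf {r. 0 < r \<and> \<bar>x\<bar> \<le> r *\<^sub>R e}"

text \<open>Convergence along a filter on the index type. For a net, the filter is generated by the
  tails of the directed index set.\<close>

definition uniformly_tendsto ::
    "('i \<Rightarrow> 'a::vector_lattice) \<Rightarrow> 'a \<Rightarrow> 'i filter \<Rightarrow> bool" where
  "uniformly_tendsto f l F \<longleftrightarrow>
     (\<exists>e\<ge>0. (\<forall>\<^sub>F i in F. f i - l \<in> principal_ideal e) \<and>
             ((\<lambda>i. ideal_norm e (f i - l)) \<longlongrightarrow> 0) F)"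

text \<open>Index types cannot be quantified over inside a definition, so closedness is phrased with
  proper filters on the space itself; a net in \<open>A\<close> corresponds to the image of its tail filter.
  Lemma \<open>uniformly_closedD\<close> recovers nets over an arbitrary index type.\<close>

definition uniformly_closed :: "'a::vector_lattice set \<Rightarrow> bool" where
  "uniformly_closed A \<longleftrightarrow>
     (\<forall>F l. F \<noteq> bot \<longrightarrow> (\<forall>\<^sub>F x in F. x \<in> A) \<longrightarrow> uniformly_tendsto (\<lambda>x. x) l F \<longrightarrow> l \<in> A)"

lemma uniformly_closedD:
  assumes "uniformly_closed A" "F \<noteq> bot" "\<forall>\<^sub>F i in F. f i \<in> A" "uniformly_tendsto f l F"
  shows "l \<in> A"
proof -
  have "filtermap f F \<noteq> bot" "\<forall>\<^sub>F x in filtermap f F. x \<in> A"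
    using assms by (auto simp: filtermap_bot_iff eventually_filtermap)
  moreover have "uniformly_tendsto (\<lambda>x. x) l (filtermap f F)"
    using assms(4) by (simp add: uniformly_tendsto_def eventually_filtermap filterlim_filtermap)
  ultimately show ?thesis
    using assms(1) unfolding uniformly_closed_def by blast
qed

lemma principal_ideal_iff:
  fixes e :: "'a::vector_lattice"
  assumes "0 \<le> e"
  shows "x \<in> principal_ideal e \<longleftrightarrow> (\<exists>r>0. \<bar>x\<bar> \<le> r *\<^sub>R e)"
proof -
  let ?I = "{x. \<exists>r>0. \<bar>x\<bar> \<le> r *\<^sub>R e}"
  have abs_scaleR_le: "\<bar>c *\<^sub>R y\<bar> \<le> \<bar>c\<bar> *\<^sub>R \<bar>y\<bar>" for c :: real and y :: 'a
  proof (cases "0 \<le> c")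
    case True
    then show ?thesis
      using scaleR_left_mono[OF abs_ge_self True, of y] scaleR_left_mono[OF abs_ge_minus_self True, of y]
      by (auto intro: abs_leI)
  next
    case False
    then have c: "0 \<le> - c" by simp
    show ?thesis
      using scaleR_left_mono[OF abs_ge_self c, of y] scaleR_left_mono[OF abs_ge_minus_self c, of y] False
      by (auto intro: abs_leI)
  qed
  have I: "order_ideal ?I"
    unfolding order_ideal_def subspace_def
  proof (intro conjI allI ballI impI; clarsimp)
    show "\<exists>r>0. 0 \<le> r *\<^sub>R e"
      using assms by (intro exI[of _ 1]) simp
  next
    fix x y r s
    assume "\<bar>x\<bar> \<le> r *\<^sub>R e" "\<bar>y\<bar> \<le> s *\<^sub>R e" "(0::real) < r" "(0::real) < s"
    then show "\<exists>t>0. \<bar>x + y\<bar> \<le> t *\<^sub>R e"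
      by (intro exI[of _ "r + s"])
         (auto simp: scaleR_left_distrib intro: order_trans[OF abs_triangle_ineq] add_mono)
  next
    fix c :: real and x r
    assume x: "\<bar>x\<bar> \<le> r *\<^sub>R e" and r: "(0::real) < r"
    have "\<bar>c *\<^sub>R x\<bar> \<le> \<bar>c\<bar> *\<^sub>R \<bar>x\<bar>" by (rule abs_scaleR_le)
    also have "\<dots> \<le> \<bar>c\<bar> *\<^sub>R r *\<^sub>R e" by (rule scaleR_left_mono[OF x]) simp
    also have "\<dots> \<le> ((\<bar>c\<bar> + 1) * r) *\<^sub>R e"
      using r assms by (auto intro!: scaleR_right_mono)
    finally show "\<exists>t>0. \<bar>c *\<^sub>R x\<bar> \<le> t *\<^sub>R e"
      using r by (intro exI[of _ "(\<bar>c\<bar> + 1) * r"]) (auto intro: add_nonneg_pos)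
  next
    fix x y r
    assume "\<bar>x\<bar> \<le> \<bar>y\<bar>" "\<bar>y\<bar> \<le> r *\<^sub>R e" "(0::real) < r"
    then show "\<exists>t>0. \<bar>x\<bar> \<le> t *\<^sub>R e"
      by (meson order_trans)
  qed
  have "principal_ideal e = ?I"
    unfolding principal_ideal_def
  proof (rule hull_unique)
    show "{e} \<subseteq> ?I"
      using assms by (auto intro!: exI[of _ "1::real"])
    show "order_ideal ?I" by (rule I)
    fix J assume J: "{e} \<subseteq> J" "order_ideal J"
    show "?I \<subseteq> J"
    proof clarify
      fix x r assume "(0::real) < r" "\<bar>x\<bar> \<le> r *\<^sub>R e"
      then have "\<bar>x\<bar> \<le> \<bar>r *\<^sub>R e\<bar>" "r *\<^sub>R e \<in> J"
        using J by (auto simp: order_ideal_def subspace_def intro: order_trans[OF _ abs_ge_self])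
      then show "x \<in> J"
        using J(2) unfolding order_ideal_def by blast
    qed
  qed
  then show ?thesis by simp
qed

lemma uniformly_tendsto_iff:
  fixes f :: "'i \<Rightarrow> 'a::vector_lattice"
  shows "uniformly_tendsto f l F \<longleftrightarrow>
    (\<exists>e\<ge>0. \<forall>\<epsilon>>0. \<forall>\<^sub>F i in F. \<bar>f i - l\<bar> \<le> \<epsilon> *\<^sub>R e)"
proof -
  have "((\<forall>\<^sub>F i in F. f i - l \<in> principal_ideal e) \<and>
          ((\<lambda>i. ideal_norm e (f i - l)) \<longlongrightarrow> 0) F) \<longleftrightarrow>
        (\<forall>\<epsilon>>0. \<forall>\<^sub>F i in F. \<bar>f i - l\<bar> \<le> \<epsilon> *\<^sub>R e)" (is "?L \<longleftrightarrow> ?R")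
    if e: "0 \<le> e" for e :: 'a
  proof
    assume L: ?L
    show ?R
    proof (intro allI impI)
      fix \<epsilon> :: real assume "\<epsilon> > 0"
      with L have "\<forall>\<^sub>F i in F. ideal_norm e (f i - l) < \<epsilon>"
        by (auto intro: order_tendstoD)
      with conjunct1[OF L] show "\<forall>\<^sub>F i in F. \<bar>f i - l\<bar> \<le> \<epsilon> *\<^sub>R e"
      proof eventually_elim
        case (elim i)
        then obtain r where "\<bar>f i - l\<bar> \<le> r *\<^sub>R e" "r < \<epsilon>"
          using cInf_lessD[of "{r. 0 < r \<and> \<bar>f i - l\<bar> \<le> r *\<^sub>R e}" \<epsilon>]
          unfolding ideal_norm_def principal_ideal_iff[OF e] by blast
        moreover have "r *\<^sub>R e \<le> \<epsilon> *\<^sub>R e"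
          using \<open>r < \<epsilon>\<close> e by (intro scaleR_right_mono) auto
        ultimately show ?case by order
      qed
    qed
  next
    assume R: ?R
    show ?L
    proof
      show "\<forall>\<^sub>F i in F. f i - l \<in> principal_ideal e"
        using R[rule_format, of 1]
        by (auto simp: principal_ideal_iff[OF e] intro: zero_less_one elim!: eventually_mono)
      show "((\<lambda>i. ideal_norm e (f i - l)) \<longlongrightarrow> 0) F"
        unfolding tendsto_iff
      proof (intro allI impI)
        fix \<epsilon> :: real assume \<epsilon>: "\<epsilon> > 0"
        then have "\<forall>\<^sub>F i in F. \<bar>f i - l\<bar> \<le> (\<epsilon>/2) *\<^sub>R e"
          using R by simp
        then show "\<forall>\<^sub>F i in F. dist (ideal_norm e (f i - l)) 0 < \<epsilon>"
        proof eventually_elim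
          case (elim i)
          let ?S = "{r. 0 < r \<and> \<bar>f i - l\<bar> \<le> r *\<^sub>R e}"
          have "\<epsilon>/2 \<in> ?S" using elim \<epsilon> by simp
          then have "Inf ?S \<le> \<epsilon>/2"
            by (rule cInf_lower) (auto intro!: bdd_belowI[of _ 0])
          moreover have "0 \<le> Inf ?S"
            using \<open>\<epsilon>/2 \<in> ?S\<close> by (intro cInf_greatest) (blast, simp)
          ultimately show ?case using \<epsilon> by (simp add: ideal_norm_def)
        qed
      qed
    qed
  qed
  then show ?thesis unfolding uniformly_tendsto_def by blast
qed

text \<open>\<open>codimension F n\<close> says that \<open>dim X/F = n\<close>: the cosets of the elements of \<open>B\<close> form a basis
  of \<open>X/F\<close>. Linear independence makes these cosets distinct, so the basis has \<open>card B\<close> elements.\<close>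

definition codimension :: "'a::real_vector set \<Rightarrow> nat \<Rightarrow> bool" where
  "codimension F n \<longleftrightarrow> subspace F \<and>
     (\<exists>B. finite B \<and> card B = n \<and>
          (\<forall>u. (\<Sum>b\<in>B. u b *\<^sub>R b) \<in> F \<longrightarrow> (\<forall>b\<in>B. u b = 0)) \<and>
          (\<forall>x. \<exists>u. x - (\<Sum>b\<in>B. u b *\<^sub>R b) \<in> F))"

end

theory Submission
  imports Defs
begin

text \<open>
  A subspace of codimension 1 is the kernel of a nonzero linear functional \<open>f\<close>. If the kernel is
  uniformly closed, then \<open>f\<close> is bounded on every order interval \<open>[0, e]\<close>: otherwise a vector \<open>w\<close>
  with \<open>f w > 0\<close> would be the uniform limit of vectors \<open>w - (f w / f y) y\<close> of the kernel, where
  \<open>y\<close> runs through elements of \<open>[0, e]\<close> at which \<open>f\<close> is arbitrarily large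
  (\<open>bounded_on_intervals_if_closed_kernel\<close>). Hence the Riesz--Kantorovich formula
  \<open>\<phi> x = sup {f y | 0 \<le> y \<le> x}\<close>, for \<open>x \<ge> 0\<close>, defines the positive part \<open>\<phi>\<close> of \<open>f\<close>, and
  \<open>\<psi> = \<phi> - f\<close> is its negative part.

  If the kernel is also a sublattice, then \<open>f\<close> cannot be positive at both of two disjoint vectors
  \<open>u\<close>, \<open>v\<close>: the scaled vectors \<open>u / f u\<close> and \<open>v / f v\<close> are disjoint, their difference lies in the
  kernel, and the positive part of this difference is \<open>u / f u\<close>, on which \<open>f\<close> is \<open>1\<close>
  (\<open>not_both_pos_on_disjoint\<close>). If \<open>\<phi>\<close> were positive at both of two disjoint vectors, then so
  would be \<open>f\<close>, at two smaller disjoint vectors; likewise for \<open>\<psi>\<close> and \<open>-f\<close>. So each of \<open>\<phi>\<close> and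
  \<open>\<psi>\<close> vanishes at one of any two disjoint vectors, which makes it a lattice homomorphism
  (\<open>lattice_homomorphism_if_disjoint\<close>).

  Conversely, lattice homomorphisms into the reals satisfy \<open>\<bar>\<phi> z\<bar> \<le> \<epsilon> * \<phi> e\<close> whenever
  \<open>\<bar>z\<bar> \<le> \<epsilon> e\<close>, so they respect uniform limits, and the set on which two lattice homomorphisms agree is
  clearly a sublattice.
\<close>

section \<open>Real-valued lattice homomorphisms\<close>

lemma lattice_homomorphism_mono:
  fixes \<phi> :: "'a::vector_lattice \<Rightarrow> real"
  assumes "lattice_homomorphism \<phi>" "x \<le> y"
  shows "\<phi> x \<le> \<phi> y"
proof -
  have "\<phi> (sup x y) = sup (\<phi> x) (\<phi> y)"
    using assms(1) by (simp add: lattice_homomorphism_def)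
  then show ?thesis using assms(2) by (simp add: sup.absorb2 le_iff_sup)
qed

lemma lattice_homomorphism_abs_le:
  fixes \<phi> :: "'a::vector_lattice \<Rightarrow> real"
  assumes hom: "lattice_homomorphism \<phi>" and z: "\<bar>z\<bar> \<le> \<epsilon> *\<^sub>R e"
  shows "\<bar>\<phi> z\<bar> \<le> \<epsilon> * \<phi> e"
proof -
  have lin: "linear \<phi>" using hom by (simp add: lattice_homomorphism_def)
  have "z \<le> \<epsilon> *\<^sub>R e" "- z \<le> \<epsilon> *\<^sub>R e"
    using z abs_ge_self[of z] abs_ge_minus_self[of z] by (meson order_trans)+
  from this[THEN lattice_homomorphism_mono[OF hom]] show ?thesis
    by (simp add: linear_cmul[OF lin] linear_neg[OF lin] abs_le_iff)
qed

text \<open>Subtracting \<open>inf x y\<close> from \<open>x\<close> and \<open>y\<close> leaves two disjoint vectors. A positive functional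
  that vanishes at one of them takes the smaller of its values at \<open>x\<close> and \<open>y\<close> at \<open>inf x y\<close>.\<close>

lemma lattice_homomorphism_if_disjoint:
  fixes \<phi> :: "'a::vector_lattice \<Rightarrow> real"
  assumes lin: "linear \<phi>" and pos: "\<And>x. 0 \<le> x \<Longrightarrow> 0 \<le> \<phi> x"
    and disj: "\<And>x y. inf x y = 0 \<Longrightarrow> \<phi> x = 0 \<or> \<phi> y = 0"
  shows "lattice_homomorphism \<phi>"
proof -
  have inf: "\<phi> (inf x y) = inf (\<phi> x) (\<phi> y)" for x y
  proof -
    let ?m = "inf x y"
    have "inf (x - ?m) (y - ?m) = 0"
      by (metis add_inf_distrib_right diff_conv_add_uminus right_minus)
    then have "\<phi> (x - ?m) = 0 \<or> \<phi> (y - ?m) = 0" by (rule disj)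
    moreover have "0 \<le> \<phi> (x - ?m)" "0 \<le> \<phi> (y - ?m)"
      by (simp_all add: pos del: diff_inf_eq_sup)
    ultimately show ?thesis
      by (auto simp: linear_diff[OF lin] inf_min simp del: diff_inf_eq_sup)
  qed
  have "\<phi> (sup x y) = sup (\<phi> x) (\<phi> y)" for x y
  proof -
    have "\<phi> (sup x y) + \<phi> (inf x y) = \<phi> x + \<phi> y"
      by (metis lin linear_add add_eq_inf_sup add.commute)
    then show ?thesis using inf[of x y] by (auto simp: inf_min sup_max min_def max_def split: if_splits)
  qed
  with inf lin show ?thesis by (simp add: lattice_homomorphism_def)
qed

lemma sublattice_equalizer:
  fixes \<phi> \<psi> :: "'a::vector_lattice \<Rightarrow> real"
  assumes "lattice_homomorphism \<phi>" "lattice_homomorphism \<psi>"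
  shows "sublattice {x. \<phi> x - \<psi> x = 0}"
proof -
  have "linear (\<lambda>x. \<phi> x - \<psi> x)"
    using assms by (simp add: lattice_homomorphism_def linear_compose_sub)
  then have "subspace {x. \<phi> x - \<psi> x = 0}" by (rule linear_subspace_kernel)
  then show ?thesis using assms by (auto simp: sublattice_def lattice_homomorphism_def)
qed

lemma uniformly_closed_equalizer:
  fixes \<phi> \<psi> :: "'a::vector_lattice \<Rightarrow> real"
  assumes hom: "lattice_homomorphism \<phi>" "lattice_homomorphism \<psi>"
  shows "uniformly_closed {x. \<phi> x - \<psi> x = 0}"
  unfolding uniformly_closed_def
proof (intro allI impI)
  fix F :: "'a filter" and l
  assume F: "F \<noteq> bot" and ev: "\<forall>\<^sub>F x in F. x \<in> {x. \<phi> x - \<psi> x = 0}"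
    and lim: "uniformly_tendsto (\<lambda>x. x) l F"
  have lin: "linear \<phi>" "linear \<psi>" using hom by (simp_all add: lattice_homomorphism_def)
  obtain e where e: "0 \<le> e" "\<And>\<epsilon>. \<epsilon> > 0 \<Longrightarrow> \<forall>\<^sub>F x in F. \<bar>x - l\<bar> \<le> \<epsilon> *\<^sub>R e"
    using lim unfolding uniformly_tendsto_iff by blast
  define K where "K = \<phi> e + \<psi> e"
  have "0 \<le> K"
    using hom[THEN lattice_homomorphism_mono, OF e(1)] lin[THEN linear_0] by (simp add: K_def)
  have bound: "\<bar>\<phi> l - \<psi> l\<bar> \<le> \<epsilon> * K" if \<epsilon>: "\<epsilon> > 0" for \<epsilon>
  proof -
    obtain x where x: "\<phi> x = \<psi> x" "\<bar>x - l\<bar> \<le> \<epsilon> *\<^sub>R e"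
      using eventually_happens'[OF F eventually_conj[OF ev e(2)[OF \<epsilon>]]] by auto
    show ?thesis
      using lattice_homomorphism_abs_le[OF hom(1) x(2)] lattice_homomorphism_abs_le[OF hom(2) x(2)] x(1)
      by (simp add: linear_diff[OF lin(1)] linear_diff[OF lin(2)] K_def algebra_simps)
  qed
  have "\<bar>\<phi> l - \<psi> l\<bar> \<le> 0 + \<delta>" if "\<delta> > 0" for \<delta>
  proof -
    have "\<bar>\<phi> l - \<psi> l\<bar> \<le> \<delta> / (K + 1) * K"
      using that \<open>0 \<le> K\<close> by (intro bound) simp
    also have "\<dots> \<le> \<delta>"
      using that \<open>0 \<le> K\<close> by (simp add: field_simps)
    finally show ?thesis by simp
  qed
  then have "\<bar>\<phi> l - \<psi> l\<bar> \<le> 0" by (rule field_le_epsilon)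
  then show "l \<in> {x. \<phi> x - \<psi> x = 0}" by simp
qed

section \<open>The positive part of a functional\<close>

text \<open>The Riesz--Kantorovich formula, meaningful for \<open>x \<ge> 0\<close> and a functional that is bounded above
  on \<open>[0, x]\<close>.\<close>

definition interval_sup :: "('a::vector_lattice \<Rightarrow> real) \<Rightarrow> 'a \<Rightarrow> real" where
  "interval_sup f x = (SUP y\<in>{0..x}. f y)"

text \<open>The extension of \<open>interval_sup f\<close> from the positive cone to the whole space, by means of the
  decomposition of \<open>x\<close> into its positive part \<open>sup x 0\<close> and its negative part \<open>sup (- x) 0\<close>.\<close>

definition positive_part :: "('a::vector_lattice \<Rightarrow> real) \<Rightarrow> 'a \<Rightarrow> real" where
  "positive_part f x = interval_sup f (sup x 0) - interval_sup f (sup (- x) 0)"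

locale interval_bounded_functional =
  fixes f :: "'a::vector_lattice \<Rightarrow> real"
  assumes lin: "linear f"
    and bdd: "\<And>x. 0 \<le> x \<Longrightarrow> bdd_above (f ` {0..x})"
begin

lemma le_interval_sup: "0 \<le> y \<Longrightarrow> y \<le> x \<Longrightarrow> f y \<le> interval_sup f x"
  unfolding interval_sup_def by (rule cSUP_upper) (auto intro: bdd)

lemma interval_sup_least:
  "0 \<le> x \<Longrightarrow> (\<And>y. 0 \<le> y \<Longrightarrow> y \<le> x \<Longrightarrow> f y \<le> c) \<Longrightarrow> interval_sup f x \<le> c"
  unfolding interval_sup_def by (rule cSUP_least) auto

lemma less_interval_supD:
  assumes "0 \<le> x" "c < interval_sup f x"
  obtains y where "0 \<le> y" "y \<le> x" "c < f y"
  using interval_sup_least[OF assms(1), of c] assms(2) by force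

lemma interval_sup_nonneg: "0 \<le> x \<Longrightarrow> 0 \<le> interval_sup f x"
  using le_interval_sup[of 0 x] by (simp add: linear_0[OF lin])

lemma interval_sup_0: "interval_sup f 0 = 0"
  using interval_sup_nonneg[of 0] interval_sup_least[of 0 0]
  by (auto simp: linear_0[OF lin] dest: antisym)

text \<open>The inequality \<open>\<le>\<close> is the Riesz decomposition property: an element \<open>z\<close> of \<open>[0, x + y]\<close> is the
  sum of \<open>inf z x\<close>, in \<open>[0, x]\<close>, and \<open>z - inf z x\<close>, in \<open>[0, y]\<close>.\<close>

lemma interval_sup_add:
  assumes x: "0 \<le> x" and y: "0 \<le> y"
  shows "interval_sup f (x + y) = interval_sup f x + interval_sup f y"
proof (rule antisym)
  show "interval_sup f (x + y) \<le> interval_sup f x + interval_sup f y"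
  proof (rule interval_sup_least)
    fix z assume z: "0 \<le> z" "z \<le> x + y"
    have "z - inf z x \<le> y"
    proof -
      have "z - y \<le> inf z x" using z y by (simp add: diff_le_eq)
      then show ?thesis by (metis diff_le_eq add.commute)
    qed
    then have "f (inf z x) + f (z - inf z x) \<le> interval_sup f x + interval_sup f y"
      using z x by (intro add_mono le_interval_sup) (auto simp del: diff_inf_eq_sup)
    then show "f z \<le> interval_sup f x + interval_sup f y"
      by (simp add: linear_diff[OF lin] del: diff_inf_eq_sup)
  qed (use x y in simp)
  have "f u \<le> interval_sup f (x + y) - interval_sup f y" if u: "0 \<le> u" "u \<le> x" for u
  proof -
    have "interval_sup f y \<le> interval_sup f (x + y) - f u"
    proof (rule interval_sup_least[OF y])
      fix v assume "0 \<le> v" "v \<le> y"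
      then have "f (u + v) \<le> interval_sup f (x + y)"
        using u by (intro le_interval_sup add_nonneg_nonneg add_mono)
      then show "f v \<le> interval_sup f (x + y) - f u" by (simp add: linear_add[OF lin])
    qed
    then show ?thesis by simp
  qed
  from interval_sup_least[OF x this]
  show "interval_sup f x + interval_sup f y \<le> interval_sup f (x + y)" by simp
qed

lemma interval_sup_scaleR:
  assumes x: "0 \<le> x" and c: "0 \<le> c"
  shows "interval_sup f (c *\<^sub>R x) = c * interval_sup f x"
proof -
  have le: "interval_sup f (c *\<^sub>R x) \<le> c * interval_sup f x" if "0 \<le> x" "c > 0" for x c
  proof (rule interval_sup_least)
    fix y assume y: "0 \<le> y" "y \<le> c *\<^sub>R x"
    have "inverse c *\<^sub>R y \<le> inverse c *\<^sub>R c *\<^sub>R x"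
      using y that by (intro scaleR_left_mono) auto
    then have "f (inverse c *\<^sub>R y) \<le> interval_sup f x"
      using y that by (intro le_interval_sup) (auto intro: scaleR_nonneg_nonneg)
    then show "f y \<le> c * interval_sup f x"
      using that by (simp add: linear_cmul[OF lin] field_simps)
  qed (use that in \<open>auto intro: scaleR_nonneg_nonneg\<close>)
  show ?thesis
  proof (cases "c = 0")
    case True
    then show ?thesis by (simp add: interval_sup_0)
  next
    case False
    then have "c > 0" using c by simp
    with le[of "c *\<^sub>R x" "inverse c"] x have "interval_sup f x \<le> inverse c * interval_sup f (c *\<^sub>R x)"
      by (auto simp: scaleR_nonneg_nonneg)
    with \<open>c > 0\<close> le[OF x \<open>c > 0\<close>] show ?thesis by (simp add: field_simps)
  qed
qed

lemma positive_part_diff: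
  assumes "0 \<le> a" "0 \<le> b"
  shows "positive_part f (a - b) = interval_sup f a - interval_sup f b"
proof -
  have "sup (a - b) 0 + b = sup (- (a - b)) 0 + a"
    using add_sup_distrib_right[of "a - b" 0 b] add_sup_distrib_right[of "- (a - b)" 0 a]
    by (simp add: sup.commute)
  then have "interval_sup f (sup (a - b) 0 + b) = interval_sup f (sup (- (a - b)) 0 + a)" by simp
  then show ?thesis
    using assms by (simp add: interval_sup_add positive_part_def del: minus_diff_eq)
qed

lemma positive_part_eq: "0 \<le> x \<Longrightarrow> positive_part f x = interval_sup f x"
  using positive_part_diff[of x 0] by (simp add: interval_sup_0)

lemma linear_positive_part: "linear (positive_part f)"
proof (rule linearI)
  have decomp: "x = sup x 0 - sup (- x) 0" for x :: 'a
  proof -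
    have "sup (- x) 0 + x = sup x 0"
      using add_sup_distrib_right[of "- x" 0 x] by (simp add: sup.commute)
    then show ?thesis by (metis add_diff_cancel_left')
  qed
  show "positive_part f (x + y) = positive_part f x + positive_part f y" for x y
  proof -
    have "x + y = (sup x 0 + sup y 0) - (sup (- x) 0 + sup (- y) 0)"
      using decomp[of x] decomp[of y] by (metis add_diff_add)
    then have "positive_part f (x + y) =
        interval_sup f (sup x 0 + sup y 0) - interval_sup f (sup (- x) 0 + sup (- y) 0)"
      by (metis positive_part_diff add_nonneg_nonneg sup.cobounded2)
    then show ?thesis by (simp add: interval_sup_add positive_part_def)
  qed
  show "positive_part f (c *\<^sub>R x) = c *\<^sub>R positive_part f x" for c x
  proof (cases "0 \<le> c")
    case True
    have "c *\<^sub>R x = c *\<^sub>R sup x 0 - c *\<^sub>R sup (- x) 0"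
      using decomp[of x] by (metis scaleR_diff_right)
    then have "positive_part f (c *\<^sub>R x) =
        interval_sup f (c *\<^sub>R sup x 0) - interval_sup f (c *\<^sub>R sup (- x) 0)"
      by (metis positive_part_diff scaleR_nonneg_nonneg True sup.cobounded2)
    with True show ?thesis by (simp add: interval_sup_scaleR positive_part_def algebra_simps)
  next
    case False
    then have c: "0 \<le> - c" by simp
    have "c *\<^sub>R x = c *\<^sub>R sup x 0 - c *\<^sub>R sup (- x) 0"
      using decomp[of x] by (metis scaleR_diff_right)
    then have "c *\<^sub>R x = (- c) *\<^sub>R sup (- x) 0 - (- c) *\<^sub>R sup x 0" by simp
    then have "positive_part f (c *\<^sub>R x) =
        interval_sup f ((- c) *\<^sub>R sup (- x) 0) - interval_sup f ((- c) *\<^sub>R sup x 0)"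
      by (metis positive_part_diff scaleR_nonneg_nonneg c sup.cobounded2)
    then show ?thesis
      by (simp only: interval_sup_scaleR[OF _ c] sup.cobounded2 positive_part_def) (simp add: algebra_simps)
  qed
qed

end

section \<open>Functionals whose kernel is a sublattice\<close>

lemma not_both_pos_on_disjoint:
  fixes f :: "'a::vector_lattice \<Rightarrow> real"
  assumes lin: "linear f" and sub: "sublattice {x. f x = 0}"
    and uv: "inf u v = 0" and pos: "0 < f u" "0 < f v"
  shows False
proof -
  define a b where "a = inverse (f u) *\<^sub>R u" and "b = inverse (f v) *\<^sub>R v"
  have ge: "0 \<le> u" "0 \<le> v" using uv inf.cobounded1[of u v] inf.cobounded2[of u v] by simp_all
  have "inf a b = 0"
  proof (rule antisym)
    \<comment> \<open>Both \<open>a\<close> and \<open>b\<close> are at most \<open>c\<close> times \<open>u\<close> and \<open>v\<close>, respectively, so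
      \<open>inf a b / c\<close> is below \<open>inf u v\<close>.\<close>
    define c where "c = inverse (f u) + inverse (f v)"
    have "c > 0" using pos by (simp add: c_def add_pos_pos)
    have "a \<le> c *\<^sub>R u" "b \<le> c *\<^sub>R v"
      using pos ge by (auto simp: a_def b_def c_def intro!: scaleR_right_mono)
    then have "inf a b \<le> c *\<^sub>R u" "inf a b \<le> c *\<^sub>R v" by (meson le_infI1 le_infI2)+
    then have "inverse c *\<^sub>R inf a b \<le> inverse c *\<^sub>R c *\<^sub>R u" "inverse c *\<^sub>R inf a b \<le> inverse c *\<^sub>R c *\<^sub>R v"
      using \<open>c > 0\<close> by (auto intro!: scaleR_left_mono simp del: scaleR_scaleR)
    then have "inverse c *\<^sub>R inf a b \<le> 0"
      using \<open>c > 0\<close> uv by (metis le_inf_iff scaleR_scaleR left_inverse scaleR_one less_irrefl)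
    then have "c *\<^sub>R inverse c *\<^sub>R inf a b \<le> c *\<^sub>R 0"
      using \<open>c > 0\<close> by (intro scaleR_left_mono) auto
    then show "inf a b \<le> 0" using \<open>c > 0\<close> by simp
    show "0 \<le> inf a b" using pos ge by (simp add: a_def b_def scaleR_nonneg_nonneg)
  qed
  then have "sup (a - b) 0 + b = a + b"
    using add_sup_distrib_right[of "a - b" 0 b] add_eq_inf_sup[of a b] by simp
  then have "sup (a - b) 0 = a" by simp
  moreover have "f (a - b) = 0"
    using pos by (simp add: a_def b_def linear_diff[OF lin] linear_cmul[OF lin])
  ultimately have "f a = 0"
    using sub linear_0[OF lin] unfolding sublattice_def by force
  then show False using pos by (simp add: a_def linear_cmul[OF lin])
qed

lemma inf_eq_0_mono:
  fixes u v x y :: "'a::vector_lattice"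
  assumes "inf x y = 0" "0 \<le> u" "u \<le> x" "0 \<le> v" "v \<le> y"
  shows "inf u v = 0"
proof (rule antisym)
  show "inf u v \<le> 0" using inf_mono[OF assms(3,5)] assms(1) by simp
  show "0 \<le> inf u v" using assms(2,4) by simp
qed

lemma difference_of_homomorphisms_if_sublattice_kernel:
  fixes f :: "'a::vector_lattice \<Rightarrow> real"
  assumes lin: "linear f" and sub: "sublattice {x. f x = 0}"
    and bdd: "\<And>x. 0 \<le> x \<Longrightarrow> bdd_above (f ` {0..x})"
  obtains \<phi> \<psi> :: "'a \<Rightarrow> real"
  where "lattice_homomorphism \<phi>" "lattice_homomorphism \<psi>" "\<And>x. f x = \<phi> x - \<psi> x"
proof
  interpret interval_bounded_functional f by (rule interval_bounded_functional.intro[OF lin bdd])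
  let ?\<phi> = "positive_part f" and ?\<psi> = "\<lambda>x. positive_part f x - f x"
  have ge: "0 \<le> x" "0 \<le> y" if "inf x y = 0" for x y :: 'a
    using that inf.cobounded1[of x y] inf.cobounded2[of x y] by simp_all
  show "lattice_homomorphism ?\<phi>"
  proof (rule lattice_homomorphism_if_disjoint[OF linear_positive_part])
    show pos: "0 \<le> ?\<phi> x" if "0 \<le> x" for x
      using that by (simp add: positive_part_eq interval_sup_nonneg)
    have D: "\<exists>u\<ge>0. u \<le> x \<and> 0 < f u" if "0 \<le> x" "?\<phi> x \<noteq> 0" for x
      using that pos[OF that(1)] less_interval_supD[of x 0]
      by (metis positive_part_eq less_eq_real_def)
    show "?\<phi> x = 0 \<or> ?\<phi> y = 0" if "inf x y = 0" for x y
      using D[OF ge(1)[OF that]] D[OF ge(2)[OF that]] inf_eq_0_mono[OF that]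
        not_both_pos_on_disjoint[OF lin sub] by blast
  qed
  have neg: "linear (\<lambda>x. - f x)" "sublattice {x. - f x = 0}"
    using lin sub by (simp_all add: linear_compose_neg)
  show "lattice_homomorphism ?\<psi>"
  proof (rule lattice_homomorphism_if_disjoint[OF linear_compose_sub[OF linear_positive_part lin]])
    show pos: "0 \<le> ?\<psi> x" if "0 \<le> x" for x
      using that le_interval_sup[of x x] by (simp add: positive_part_eq)
    have D: "\<exists>u\<ge>0. u \<le> x \<and> 0 < - f u" if x: "0 \<le> x" "?\<psi> x \<noteq> 0" for x
    proof -
      have "f x < interval_sup f x"
        using x pos[OF x(1)] by (simp add: positive_part_eq)
      then obtain y where "0 \<le> y" "y \<le> x" "f x < f y"
        using less_interval_supD[OF x(1)] by blast
      \<comment> \<open>\<open>f (x - y) = f x - f y < 0\<close>\<close>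
      then show ?thesis by (intro exI[of _ "x - y"]) (simp add: linear_diff[OF lin])
    qed
    show "?\<psi> x = 0 \<or> ?\<psi> y = 0" if "inf x y = 0" for x y
      using D[OF ge(1)[OF that]] D[OF ge(2)[OF that]] inf_eq_0_mono[OF that]
        not_both_pos_on_disjoint[OF neg] by blast
  qed
  show "f x = ?\<phi> x - ?\<psi> x" for x by simp
qed

section \<open>Functionals whose kernel is uniformly closed\<close>

lemma bounded_on_intervals_if_closed_kernel:
  fixes f :: "'a::vector_lattice \<Rightarrow> real"
  assumes lin: "linear f" and closed: "uniformly_closed {x. f x = 0}" and e: "0 \<le> e"
  shows "bdd_above (f ` {0..e})"
proof (rule ccontr)
  assume "\<not> ?thesis"
  then have "\<exists>y. 0 \<le> y \<and> y \<le> e \<and> real (Suc n) < f y" for n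
    unfolding bdd_above_def by (force simp: not_le)
  then obtain y where y: "\<And>n. 0 \<le> y n" "\<And>n. y n \<le> e" "\<And>n. real (Suc n) < f (y n)"
    by metis
  have fy: "0 < f (y n)" for n using y(3)[of n] by linarith
  define w where "w = y 0"
  define x where "x n = w - (f w / f (y n)) *\<^sub>R y n" for n
  have "f (x n) = 0" for n
    using fy[of n] by (simp add: x_def linear_diff[OF lin] linear_cmul[OF lin])
  moreover have "uniformly_tendsto x w sequentially"
    unfolding uniformly_tendsto_iff
  proof (intro exI[of _ e] conjI allI impI e)
    fix \<epsilon> :: real assume "\<epsilon> > 0"
    then obtain N :: nat where N: "f w / \<epsilon> < real N" using reals_Archimedean2 by blast
    have "\<bar>x n - w\<bar> \<le> \<epsilon> *\<^sub>R e" if "n \<ge> N" for n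
    proof -
      let ?c = "f w / f (y n)"
      have c: "0 \<le> ?c" using fy[of n] fy[of 0] by (simp add: w_def)
      have "f w / \<epsilon> \<le> f (y n)" using N that y(3)[of n] by linarith
      then have "?c \<le> \<epsilon>" using \<open>\<epsilon> > 0\<close> fy[of n] by (simp add: field_simps)
      have "\<bar>x n - w\<bar> = ?c *\<^sub>R y n"
        using c y(1)[of n] by (simp add: x_def scaleR_nonneg_nonneg)
      also have "\<dots> \<le> \<epsilon> *\<^sub>R e"
        using c \<open>?c \<le> \<epsilon>\<close> y(1,2)[of n] \<open>\<epsilon> > 0\<close> by (intro scaleR_mono) auto
      finally show ?thesis .
    qed
    then show "\<forall>\<^sub>F n in sequentially. \<bar>x n - w\<bar> \<le> \<epsilon> *\<^sub>R e"
      by (auto simp: eventually_sequentially)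
  qed
  ultimately have "w \<in> {x. f x = 0}"
    by (intro uniformly_closedD[OF closed sequentially_bot]) auto
  then show False using fy[of 0] by (simp add: w_def)
qed

section \<open>Subspaces of codimension one\<close>

lemma codimension_1_kernel:
  fixes Y :: "'a::real_vector set"
  assumes "codimension Y 1"
  obtains f :: "'a \<Rightarrow> real" where "linear f" "Y = {x. f x = 0}"
proof -
  obtain B where Y: "subspace Y" and "card B = 1"
    and B: "\<And>u. (\<Sum>b\<in>B. u b *\<^sub>R b) \<in> Y \<Longrightarrow> \<forall>b\<in>B. u b = 0"
      "\<And>x. \<exists>u. x - (\<Sum>b\<in>B. u b *\<^sub>R b) \<in> Y"
    using assms unfolding codimension_def by blast
  obtain b where b: "B = {b}" using \<open>card B = 1\<close> by (rule card_1_singletonE)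
  have indep: "c = 0" if "c *\<^sub>R b \<in> Y" for c
    using B(1)[of "\<lambda>_. c"] that by (simp add: b)
  have "\<exists>c. x - c *\<^sub>R b \<in> Y" for x
    using B(2)[of x] by (auto simp: b)
  then obtain f where f: "\<And>x. x - f x *\<^sub>R b \<in> Y" by metis
  have eq: "f x = c" if "x - c *\<^sub>R b \<in> Y" for x c
  proof -
    have "(f x - c) *\<^sub>R b \<in> Y"
      using subspace_diff[OF Y that f[of x]] by (simp add: algebra_simps)
    then show ?thesis using indep by fastforce
  qed
  show thesis
  proof
    show "linear f"
    proof (rule linearI)
      show "f (x + y) = f x + f y" for x y
        using subspace_add[OF Y f[of x] f[of y]] by (intro eq) (simp add: algebra_simps)
      show "f (c *\<^sub>R x) = c *\<^sub>R f x" for c x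
        using subspace_scale[OF Y f[of x], of c] by (intro eq) (simp add: algebra_simps)
    qed
    show "Y = {x. f x = 0}"
      using f eq[of _ 0] by (auto) (metis diff_zero scaleR_zero_left)
  qed
qed

theorem proposition5p4:
  fixes Y :: "'a::archimedean_vector_lattice set"
  assumes "subspace Y" and "codimension Y 1"
  shows "uniformly_closed Y \<and> sublattice Y \<longleftrightarrow>
    (\<exists>\<phi> \<psi> :: 'a \<Rightarrow> real. lattice_homomorphism \<phi> \<and> lattice_homomorphism \<psi> \<and>
       Y = {x. \<phi> x - \<psi> x = 0})"
proof
  assume L: "uniformly_closed Y \<and> sublattice Y"
  obtain f :: "'a \<Rightarrow> real" where f: "linear f" "Y = {x. f x = 0}"
    using codimension_1_kernel[OF assms(2)] .
  with L have closed: "uniformly_closed {x. f x = 0}" and sub: "sublattice {x. f x = 0}"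
    by simp_all
  obtain \<phi> \<psi> :: "'a \<Rightarrow> real"
    where hom: "lattice_homomorphism \<phi>" "lattice_homomorphism \<psi>"
      and f_eq: "\<And>x. f x = \<phi> x - \<psi> x"
    using difference_of_homomorphisms_if_sublattice_kernel[OF f(1) sub
        bounded_on_intervals_if_closed_kernel[OF f(1) closed]]
    by blast
  have "Y = {x. \<phi> x - \<psi> x = 0}" by (simp only: f(2) f_eq)
  with hom show "\<exists>\<phi> \<psi> :: 'a \<Rightarrow> real. lattice_homomorphism \<phi> \<and> lattice_homomorphism \<psi> \<and>
       Y = {x. \<phi> x - \<psi> x = 0}"
    by (intro exI conjI)
next
  assume "\<exists>\<phi> \<psi> :: 'a \<Rightarrow> real. lattice_homomorphism \<phi> \<and> lattice_homomorphism \<psi> \<and>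
       Y = {x. \<phi> x - \<psi> x = 0}"
  then obtain \<phi> \<psi> :: "'a \<Rightarrow> real"
    where hom: "lattice_homomorphism \<phi>" "lattice_homomorphism \<psi>"
      and Y: "Y = {x. \<phi> x - \<psi> x = 0}"
    by (elim exE conjE)
  show "uniformly_closed Y \<and> sublattice Y"
    unfolding Y using uniformly_closed_equalizer[OF hom] sublattice_equalizer[OF hom] by (rule conjI)
qed

end
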